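(* Let $T$ be the linear operator on real polynomials defined by $T(x^n)=p_n$, $n\ge0$. (1) If $p_n=L_n^\alpha$, where $\alpha>-1$ is not a non-negative integer, then $T$ preserves real-rootedness up to degree $K$ if and only if $\alpha>K-2$. (2) If $p_n=L_n^\alpha$, with $\alpha$ a non-negative integer, then $T$ preserves real-rootedness. (3) If $p_n=\mathcal L_n^\alpha$ with $\alpha>-1$, then $T$ preserves real-rootedness. (4) If $p_n=\mathfrak L_n^\alpha$ with $\alpha>-1$, then $T$ preserves real-rootedness.
   Context: $L_n^\alpha(x)=\sum_{j=0}^n\binom{n+\alpha}{n-j}\frac{(-x)^j}{j!}$ is the Laguerre polynomial; with $(u)_s=u(u+1)\cdots(u+s-1)$, $\mathcal L_n^\alpha=\frac{n!}{(1+\alpha)_n}L_n^\alpha$ and $\mathfrak L_n^\alpha=\frac{1}{(1+\alpha)_n}L_n^\alpha$. Given a linear operator $T$ acting in the linear space of real polynomials with $\deg T(p)=\deg p$, and a positive integer $K$, $T$ is said to preserve real-rootedness up to degree $K$ if for any polynomial $p$ having only real zeros and degree at most $K$, the polynomial $T(p)$ also has only real zeros. $T$ preserves real-rootedness if it preserves real-rootedness up to degree $K$ for all positive integers $K$. *)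

theory Defs
  imports Complex_Main "HOL-Computational_Algebra.Polynomial"
begin

definition laguerre :: "real \<Rightarrow> nat \<Rightarrow> real poly" where
  "laguerre \<alpha> n =
     (\<Sum>j\<le>n. smult (((real n + \<alpha>) gchoose (n - j)) / fact j) ([:0, -1:] ^ j))"

definition laguerre_cal :: "real \<Rightarrow> nat \<Rightarrow> real poly" where
  "laguerre_cal \<alpha> n = smult (fact n / pochhammer (1 + \<alpha>) n) (laguerre \<alpha> n)"

definition laguerre_frak :: "real \<Rightarrow> nat \<Rightarrow> real poly" where
  "laguerre_frak \<alpha> n = smult (1 / pochhammer (1 + \<alpha>) n) (laguerre \<alpha> n)"

text \<open>Nonzero constants have only real zeros vacuously; the zero polynomial does not have only
  real zeros.  The latter choice is immaterial for linear operators that preserve degrees and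
  are hence injective.\<close>

definition only_real_zeros :: "real poly \<Rightarrow> bool" where
  "only_real_zeros p \<longleftrightarrow>
     (\<forall>z::complex. poly (map_poly complex_of_real p) z = 0 \<longrightarrow> z \<in> \<real>)"

definition preserves_real_rootedness_upto :: "nat \<Rightarrow> (real poly \<Rightarrow> real poly) \<Rightarrow> bool" where
  "preserves_real_rootedness_upto K T \<longleftrightarrow>
     (\<forall>p. only_real_zeros p \<and> degree p \<le> K \<longrightarrow> only_real_zeros (T p))"

definition preserves_real_rootedness :: "(real poly \<Rightarrow> real poly) \<Rightarrow> bool" where
  "preserves_real_rootedness T \<longleftrightarrow> (\<forall>K>0. preserves_real_rootedness_upto K T)"

end

theory Submission
  imports Defs "HOL-Computational_Algebra.Fundamental_Theorem_Algebra"
begin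

text \<open>
  Write \<open>(u)\<^sub>k\<close> for the Pochhammer symbol.  The polynomial \<^term>\<open>laguerre_cal \<alpha> n\<close> is
  \<open>\<Sum>k (n choose k) (-x)^k / (1+\<alpha>)\<^sub>k\<close>, so it is the image of \<open>(1+x)^n\<close> under the diagonal map
  \<open>x^k \<mapsto> x^k / (1+\<alpha>)\<^sub>k\<close> followed by \<open>x \<mapsto> -x\<close>.  Each operator \<open>T\<close> with
  \<open>T(x^n) = \<mu>\<^sub>n laguerre_cal \<alpha> n\<close> is therefore a composition: the diagonal map
  \<open>x^n \<mapsto> \<mu>\<^sub>n x^n\<close>, the shift \<open>x \<mapsto> 1+x\<close>, the diagonal map with entries \<open>1/(1+\<alpha>)\<^sub>k\<close>, and the
  reflection (\<open>laguerre_operator_factorization\<close>).  The three families have \<open>\<mu>\<^sub>n = (1+\<alpha>)\<^sub>n/n!\<close>,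
  \<open>\<mu>\<^sub>n = 1\<close> and \<open>\<mu>\<^sub>n = 1/n!\<close>.  Real-rootedness is now a question about diagonal maps.

  The criterion for diagonal maps is that of Polya and Schur
  (\<open>only_real_zeros_diag_op\<close>): a positive sequence \<open>\<gamma>\<close> preserves real-rootedness up to degree \<open>n\<close> as
  soon as its Jensen polynomial \<open>\<Sum>k (n choose k) \<gamma>\<^sub>k x^k\<close> is real-rooted.  It follows from a
  composition theorem in the style of Schur and Szego, which in turn is obtained by iterating
  Laguerre's theorem on polar derivatives in the upper half-plane.

  The Jensen polynomials that occur are Laguerre polynomials, for \<open>1/(1+\<alpha>)\<^sub>k\<close>, and Jacobi polynomials,
  for \<open>(1+\<alpha>)\<^sub>k/k!\<close>.  Both satisfy first-order differential recurrences that express the polynomial of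
  degree \<open>n+1\<close> through one of degree \<open>n\<close>, say \<open>q\<close>.  When the zeros \<open>r\<close> of \<open>q\<close> are real,
  \<open>q'/q = \<Sum> 1/(x-r)\<close> has nonpositive imaginary part in the upper half-plane, and the recurrences exhibit
  the new polynomial, up to nonvanishing factors, as \<open>q\<close> times an expression that is never real there.
  In the Jacobi case this needs the zeros of \<open>q\<close> to lie in \<open>[-1,0]\<close>, which holds for \<open>\<alpha> > n-1 = (n+1)-2\<close>; this is where the bound \<open>\<alpha> > K-2\<close> comes from.  When
  \<open>\<alpha>\<close> is a natural number \<open>m\<close>, the entries \<open>(1+\<alpha>)\<^sub>n/n!\<close> are the product of the factors \<open>(n+i)/i\<close>
  over \<open>1 \<le> i \<le> m\<close>, each of which preserves real-rootedness in all degrees.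

  Conversely, the identity \<open>L\<^sub>n\<^sub>+\<^sub>1^\<alpha> - L\<^sub>n^\<alpha> = L\<^sub>n\<^sub>+\<^sub>1^(\<alpha>-1)\<close> gives
  \<open>T((x-1)^K) = L\<^sub>K^(\<alpha>-K)\<close> (\<open>laguerre_operator_power\<close>), and for non-integral \<open>\<alpha> < K-2\<close> the three
  lowest coefficients of this polynomial violate Laguerre's inequality
  \<open>a\<^sub>1^2 \<ge> 2 a\<^sub>0 a\<^sub>2\<close>.
\<close>

section \<open>Real polynomials on the upper half-plane\<close>

abbreviation cpoly :: "real poly \<Rightarrow> complex poly" where
  "cpoly \<equiv> map_poly complex_of_real"

lemma cpoly_add [simp]: "cpoly (p + q) = cpoly p + cpoly q"
  by (rule poly_eqI) (simp add: coeff_map_poly)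

lemma cpoly_smult [simp]: "cpoly (smult c p) = smult (of_real c) (cpoly p)"
  by (rule poly_eqI) (simp add: coeff_map_poly)

lemma cpoly_pCons [simp]: "cpoly (pCons a p) = pCons (of_real a) (cpoly p)"
  by (rule map_poly_pCons) simp

lemma cpoly_mult [simp]: "cpoly (p * q) = cpoly p * cpoly q"
  by (induction p) (simp_all add: algebra_simps)

lemma cpoly_pderiv: "cpoly (pderiv p) = pderiv (cpoly p)"
  by (rule poly_eqI) (simp add: coeff_map_poly coeff_pderiv)

lemma cpoly_pcompose_linear:
  "poly (cpoly (pcompose p [:a, b:])) z = poly (cpoly p) (of_real a + of_real b * z)"
  by (induction p) (simp_all add: pcompose_pCons algebra_simps)

lemma cpoly_prod_linear:
  "cpoly (\<Prod>r\<in>#A. [:- r, 1:]) = (\<Prod>r\<in>#A. [:- of_real r, 1:])"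
  by (induction A) (simp_all del: mult_pCons_left)

lemma poly_cpoly_cnj: "poly (cpoly p) (cnj z) = cnj (poly (cpoly p) z)"
  by (induction p) simp_all

lemma poly_cpoly_of_real: "poly (cpoly p) (of_real x) = of_real (poly p x)"
  by (induction p) simp_all

text \<open>Nonreal zeros of a real polynomial come in conjugate pairs, so one half-plane suffices.  In this form the
  property extends to complex polynomials, which is what the polar derivative below requires.\<close>

lemma only_real_zeros_iff_upper_half_plane:
  "only_real_zeros p \<longleftrightarrow> (\<forall>z. Im z > 0 \<longrightarrow> poly (cpoly p) z \<noteq> 0)"
proof
  assume "only_real_zeros p"
  then show "\<forall>z. Im z > 0 \<longrightarrow> poly (cpoly p) z \<noteq> 0"
    unfolding only_real_zeros_def by (metis complex_is_Real_iff less_irrefl)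
next
  assume *: "\<forall>z. Im z > 0 \<longrightarrow> poly (cpoly p) z \<noteq> 0"
  show "only_real_zeros p"
    unfolding only_real_zeros_def
  proof (intro allI impI)
    fix z assume z: "poly (cpoly p) z = 0"
    then have "poly (cpoly p) (cnj z) = 0" by (simp add: poly_cpoly_cnj)
    with z * have "\<not> Im z > 0" "\<not> Im (cnj z) > 0" by blast+
    then show "z \<in> \<real>" by (simp add: complex_is_Real_iff)
  qed
qed

lemma only_real_zeros_imp_nonzero: "only_real_zeros p \<Longrightarrow> p \<noteq> 0"
  using only_real_zeros_iff_upper_half_plane[of p, THEN iffD1, rule_format, of \<i>] by auto

lemma only_real_zeros_pcompose_linear:
  assumes "only_real_zeros p" "b \<noteq> 0"
  shows "only_real_zeros (pcompose p [:a, b:])"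
proof -
  have "z \<in> \<real>" if "poly (cpoly (pcompose p [:a, b:])) z = 0" for z
  proof -
    have "of_real a + of_real b * z \<in> \<real>"
      using that assms(1) by (simp add: cpoly_pcompose_linear only_real_zeros_def)
    then show ?thesis using assms(2) by (simp add: complex_is_Real_iff)
  qed
  then show ?thesis by (simp add: only_real_zeros_def)
qed

lemma only_real_zeros_smult:
  "c \<noteq> 0 \<Longrightarrow> only_real_zeros (smult c p) \<longleftrightarrow> only_real_zeros p"
  by (simp add: only_real_zeros_def)

lemma only_real_zeros_mult_iff:
  "only_real_zeros (p * q) \<longleftrightarrow> only_real_zeros p \<and> only_real_zeros q"
  unfolding only_real_zeros_def by auto

lemma only_real_zeros_imp_root:
  assumes "only_real_zeros p" "degree p > 0"
  obtains r q where "p = [:- r, 1:] * q" "only_real_zeros q" "degree p = Suc (degree q)"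
proof -
  have "degree (cpoly p) > 0"
    using assms(2) by (simp add: degree_map_poly)
  then obtain z where z: "poly (cpoly p) z = 0"
    using alg_closed_imp_poly_has_root by blast
  with assms(1) obtain r where "z = of_real r"
    unfolding only_real_zeros_def by (metis Reals_cases)
  with z have "poly p r = 0" by (simp add: poly_cpoly_of_real)
  then obtain q where q: "p = [:- r, 1:] * q"
    by (metis dvdE poly_eq_0_iff_dvd)
  moreover have "q \<noteq> 0" using q assms(2) by auto
  ultimately have "degree p = Suc (degree q)"
    by (metis degree_pCons_eq degree_mult_eq degree_pCons_0 one_neq_zero pCons_eq_0_iff plus_1_eq_Suc One_nat_def)
  with q assms(1) that show ?thesis by (simp only: only_real_zeros_mult_iff)
qed

lemma only_real_zeros_factorization:
  assumes "only_real_zeros p"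
  shows "p = smult (lead_coeff p) (\<Prod>r\<in>#proots p. [:- r, 1:])"
  using assms
proof (induction "degree p" arbitrary: p rule: less_induct)
  case less
  show ?case
  proof (cases "degree p = 0")
    case True
    then show ?thesis by (auto elim!: degree_eq_zeroE)
  next
    case False
    then obtain r q where q: "p = [:- r, 1:] * q" "only_real_zeros q" "degree p = Suc (degree q)"
      using only_real_zeros_imp_root less.prems by blast
    then have "q \<noteq> 0" using False by auto
    then have "proots p = add_mset r (proots q)"
      unfolding q(1) by (subst proots_mult) auto
    moreover have "lead_coeff p = lead_coeff q"
      unfolding q(1) lead_coeff_mult by simp
    moreover have "q = smult (lead_coeff q) (\<Prod>r\<in>#proots q. [:- r, 1:])"
      using less.hyps q by simp
    ultimately show ?thesis
      by (metis q(1) image_mset_add_mset prod_mset.add_mset mult_smult_right)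
  qed
qed

text \<open>Laguerre's inequality \<open>p'^2 \<ge> p p''\<close> at the origin.  Splitting off a factor \<open>x - r\<close>, with \<open>p = (x-r) q\<close>, turns
  \<open>a\<^sub>1^2 - 2 a\<^sub>0 a\<^sub>2\<close> for \<open>p\<close> into \<open>b\<^sub>0^2\<close> plus \<open>r^2\<close> times the same expression for \<open>q\<close>,
  where \<open>b\<^sub>0\<close> is the constant coefficient of \<open>q\<close>.\<close>

lemma laguerre_inequality:
  "only_real_zeros p \<Longrightarrow> 2 * coeff p 0 * coeff p 2 \<le> (coeff p 1)\<^sup>2"
proof (induction "degree p" arbitrary: p rule: less_induct)
  case less
  show ?case
  proof (cases "degree p = 0")
    case True
    then show ?thesis by (simp add: coeff_eq_0)
  next
    case False
    then obtain r q where q: "p = [:- r, 1:] * q" "only_real_zeros q" "degree p = Suc (degree q)"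
      using only_real_zeros_imp_root less.prems by blast
    have c: "coeff p 0 = - r * coeff q 0" "coeff p 1 = coeff q 0 - r * coeff q 1"
      "coeff p 2 = coeff q 1 - r * coeff q 2"
      by (simp_all add: q(1) numeral_2_eq_2)
    have "(coeff p 1)\<^sup>2 - 2 * coeff p 0 * coeff p 2
      = (coeff q 0)\<^sup>2 + r\<^sup>2 * ((coeff q 1)\<^sup>2 - 2 * coeff q 0 * coeff q 2)"
      unfolding c by (simp add: power2_eq_square algebra_simps)
    also have "\<dots> \<ge> 0" using less.hyps[of q] q by simp
    finally show ?thesis by simp
  qed
qed

lemma poly_pderiv_prod_linear:
  fixes A :: "'a :: field multiset"
  assumes "\<forall>r\<in>#A. x \<noteq> r"
  shows "poly (pderiv (\<Prod>r\<in>#A. [:- r, 1:])) x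
       = poly (\<Prod>r\<in>#A. [:- r, 1:]) x * (\<Sum>r\<in>#A. 1 / (x - r))"
  using assms
  by (induction A) (simp_all add: pderiv_mult pderiv_pCons field_simps del: mult_pCons_left)

lemma poly_prod_linear_nonzero:
  fixes A :: "'a :: field multiset"
  shows "poly (\<Prod>r\<in>#A. [:- r, 1:]) x \<noteq> 0 \<longleftrightarrow> (\<forall>r\<in>#A. x \<noteq> r)"
  by (induction A) auto

lemma poly_pderiv_eq_sum_roots:
  assumes "p = smult c (\<Prod>r\<in>#A. [:- r, 1:])" "poly p x \<noteq> (0 :: 'a :: field)"
  shows "poly (pderiv p) x = poly p x * (\<Sum>r\<in>#A. 1 / (x - r))"
proof -
  have "\<forall>r\<in>#A. x \<noteq> r"
    using assms poly_prod_linear_nonzero[of A x] by auto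
  from poly_pderiv_prod_linear[OF this] show ?thesis
    unfolding assms(1) by (simp add: pderiv_smult mult.assoc)
qed

lemma only_real_zeros_log_derivative:
  assumes "only_real_zeros p" "Im z > 0"
  shows "poly (cpoly (pderiv p)) z = poly (cpoly p) z * (\<Sum>r\<in>#proots p. 1 / (z - of_real r))"
proof -
  have "cpoly p = smult (of_real (lead_coeff p)) (\<Prod>r\<in>#proots p. [:- of_real r, 1:])"
    by (subst only_real_zeros_factorization[OF assms(1)]) (simp add: cpoly_prod_linear)
  then have "cpoly p = smult (of_real (lead_coeff p))
     (\<Prod>r\<in>#image_mset complex_of_real (proots p). [:- r, 1:])"
    by (simp add: image_mset.compositionality comp_def)
  from poly_pderiv_eq_sum_roots[OF this, of z] assms show ?thesis
    by (simp add: cpoly_pderiv only_real_zeros_iff_upper_half_plane image_mset.compositionality comp_def)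
qed

lemma Im_inverse_neg: "Im z > Im r \<Longrightarrow> Im (1 / (z - r)) < 0"
  by (simp add: Im_divide divide_neg_pos sum_power2_gt_zero_iff)

lemma Im_sum_mset: "Im (\<Sum>x\<in>#A. f x) = (\<Sum>x\<in>#A. Im (f x))"
  by (induction A) simp_all

lemma sum_mset_real_nonneg: "(\<And>x. x \<in># A \<Longrightarrow> f x \<ge> (0 :: real)) \<Longrightarrow> (\<Sum>x\<in>#A. f x) \<ge> 0"
  by (induction A) auto

lemma sum_mset_real_nonpos: "(\<And>x. x \<in># A \<Longrightarrow> f x \<le> (0 :: real)) \<Longrightarrow> (\<Sum>x\<in>#A. f x) \<le> 0"
  by (induction A) (auto intro!: add_nonpos_nonpos)

lemma Im_log_derivative_nonpos:
  assumes "Im z > 0"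
  shows "Im (\<Sum>r\<in>#A. 1 / (z - complex_of_real r)) \<le> 0"
proof (induction A)
  case (add r A)
  moreover have "Im (1 / (z - complex_of_real r)) < 0"
    using assms by (intro Im_inverse_neg) simp
  ultimately show ?case by simp
qed simp

section \<open>Polar derivatives and the composition theorem\<close>

text \<open>The map \<open>r \<mapsto> 1/(x-r)\<close> carries the closed lower half-plane into the closed disc with centre
  \<open>-\<i>/(2 Im x)\<close> and radius \<open>1/(2 Im x)\<close>, and every point \<open>r \<noteq> x\<close> of the open upper half-plane out of it.\<close>

lemma norm_inverse_disc_iff:
  assumes "Im x > 0" "x \<noteq> r"
  shows "norm (1 / (x - r) + \<i> / of_real (2 * Im x)) \<le> 1 / (2 * Im x) \<longleftrightarrow> Im r \<le> 0"
proof -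
  define d y where "d = x - r" and "y = Im x"
  have d: "d \<noteq> 0" and y: "y > 0" using assms by (simp_all add: d_def y_def)
  have "1 / d + \<i> / of_real (2 * y) = (of_real (2 * y) + \<i> * d) / (of_real (2 * y) * d)"
    using d y by (simp add: field_simps)
  then have "norm (1 / d + \<i> / of_real (2 * y)) = norm (of_real (2 * y) + \<i> * d) / (2 * y * norm d)"
    using y by (simp add: norm_divide norm_mult)
  also have "\<dots> \<le> 1 / (2 * y) \<longleftrightarrow> norm (of_real (2 * y) + \<i> * d) \<le> norm d"
    using d y by (simp add: divide_simps)
  also have "\<dots> \<longleftrightarrow> (norm (of_real (2 * y) + \<i> * d))\<^sup>2 \<le> (norm d)\<^sup>2"
    by (simp add: power2_le_iff_abs_le)
  also have "\<dots> \<longleftrightarrow> 4 * y * (y - Im d) \<le> 0"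
    unfolding cmod_power2 by (simp add: power2_eq_square algebra_simps)
  also have "\<dots> \<longleftrightarrow> Im r \<le> 0"
    using y by (simp add: d_def y_def mult_le_0_iff)
  finally show ?thesis by (simp add: d_def y_def)
qed

text \<open>Convexity of the disc with centre \<open>-c\<close> and radius \<open>R\<close>: the average of \<open>n\<close> of its points lies in it.  The
  points are the \<open>f r\<close>, completed to \<open>n\<close> points by copies of \<open>0\<close>; the zeros stand for roots at infinity of
  a polynomial whose degree is less than \<open>n\<close>.\<close>

lemma norm_sum_mset_disc:
  assumes "\<forall>r\<in>#A. norm (f r + c) \<le> R" "norm c \<le> R" "size A \<le> n"
  shows "norm ((\<Sum>r\<in>#A. f r) + of_nat n * (c :: complex)) \<le> of_nat n * R"
proof -
  have "norm ((\<Sum>r\<in>#A. f r) + of_nat (size A) * c) \<le> of_nat (size A) * R"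
    using assms(1)
  proof (induction A)
    case (add r A)
    have "norm ((\<Sum>r\<in>#add_mset r A. f r) + of_nat (size (add_mset r A)) * c)
       \<le> norm (f r + c) + norm ((\<Sum>r\<in>#A. f r) + of_nat (size A) * c)"
      by (rule order_trans[OF _ norm_triangle_ineq]) (simp add: algebra_simps)
    with add show ?case by (simp add: algebra_simps)
  qed simp
  moreover have "norm (of_nat (n - size A) * c) \<le> of_nat (n - size A) * R"
    using assms(2) by (simp add: norm_mult mult_left_mono)
  moreover have "(\<Sum>r\<in>#A. f r) + of_nat n * c
     = ((\<Sum>r\<in>#A. f r) + of_nat (size A) * c) + of_nat (n - size A) * c"
    using assms(3) by (simp add: of_nat_diff algebra_simps)
  ultimately show ?thesis
    using norm_triangle_ineq[of "(\<Sum>r\<in>#A. f r) + of_nat (size A) * c" "of_nat (n - size A) * c"] assms(3)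
    by (simp add: of_nat_diff algebra_simps)
qed

text \<open>Laguerre's theorem for the upper half-plane.  A zero \<open>x\<close> of the polar derivative satisfies
  \<open>1/(x-w) = (1/n) \<Sum> 1/(x-r)\<close>, where the \<open>r\<close> are the zeros of \<open>f\<close>.  The right-hand side is an average of
  points of the disc described above, while \<open>1/(x-w)\<close> lies outside it.\<close>

lemma polar_derivative_nonzero:
  assumes nz: "\<And>x. Im x > 0 \<Longrightarrow> poly f x \<noteq> 0"
    and deg: "degree f \<le> n" and n: "n > 0" and w: "Im w > 0" and x: "Im x > 0"
  shows "of_nat n * poly f x + (w - x) * poly (pderiv f) x \<noteq> 0"
proof
  assume eq: "of_nat n * poly f x + (w - x) * poly (pderiv f) x = 0"
  define S where "S = (\<Sum>r\<in>#proots f. 1 / (x - r))"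
  have "poly (pderiv f) x = poly f x * S"
    unfolding S_def by (rule poly_pderiv_eq_sum_roots[OF complex_poly_decompose_multiset[symmetric]])
      (simp add: nz x)
  with eq have "poly f x * (of_nat n - (x - w) * S) = 0"
    by (simp add: algebra_simps)
  then have nS: "(x - w) * S = of_nat n" using nz[OF x] by simp
  then have xw: "x \<noteq> w" using n by auto
  define c where "c = \<i> / of_real (2 * Im x)"
  define R where "R = 1 / (2 * Im x)"
  have f0: "f \<noteq> 0" using nz[OF x] by auto
  have "norm (1 / (x - r) + c) \<le> R" if "r \<in># proots f" for r
  proof -
    have "poly f r = 0" using that f0 by simp
    then have "Im r \<le> 0" "x \<noteq> r" using nz x by (force simp: not_less[symmetric])+
    then show ?thesis unfolding c_def R_def by (subst norm_inverse_disc_iff) (use x in auto)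
  qed
  moreover have "norm c \<le> R" using x by (simp add: c_def R_def norm_divide)
  moreover have "size (proots f) \<le> n" using deg by (simp add: size_proots_complex)
  ultimately have "norm (S + of_nat n * c) \<le> of_nat n * R"
    unfolding S_def by (intro norm_sum_mset_disc) auto
  moreover have "S + of_nat n * c = of_nat n * (1 / (x - w) + c)"
    using nS xw by (simp add: field_simps)
  ultimately have "norm (1 / (x - w) + c) \<le> R"
    using n by (simp add: norm_mult)
  then show False
    using norm_inverse_disc_iff[OF x xw] w by (simp add: c_def R_def)
qed

text \<open>For real sequences these are the Jensen polynomials.  Conversely every polynomial of degree at most \<open>n\<close>
  over a field of characteristic zero has this form for some \<open>a\<close>, and \<open>n\<close> then serves as its formal
  degree.\<close>

definition binomial_poly :: "nat \<Rightarrow> (nat \<Rightarrow> 'a) \<Rightarrow> 'a :: comm_semiring_1 poly" where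
  "binomial_poly n a = (\<Sum>k\<le>n. monom (of_nat (n choose k) * a k) k)"

lemma coeff_binomial_poly [simp]: "coeff (binomial_poly n a) k = of_nat (n choose k) * a k"
  by (simp add: binomial_poly_def coeff_sum sum.delta binomial_eq_0)

lemma degree_binomial_poly_le: "degree (binomial_poly n a) \<le> n"
  by (rule degree_le) (simp add: binomial_eq_0)

lemma degree_prod_linear: "degree (\<Prod>t\<in>#B. [:f t, 1 :: 'a :: idom:]) = size B"
proof (induction B)
  case (add t B)
  then show ?case by (subst image_mset_add_mset, subst prod_mset.add_mset, subst degree_mult_eq) auto
qed simp

text \<open>On normalised coefficients the polar derivative with pole \<open>w\<close> is the map
  \<open>a\<^sub>k \<mapsto> a\<^sub>k + w a\<^sub>k\<^sub>+\<^sub>1\<close>.\<close>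

lemma polar_derivative_binomial_poly:
  fixes a :: "nat \<Rightarrow> complex"
  shows "smult (of_nat (Suc n)) (binomial_poly n (\<lambda>k. a k + w * a (Suc k)))
    = smult (of_nat (Suc n)) (binomial_poly (Suc n) a) + [:w, -1:] * pderiv (binomial_poly (Suc n) a)"
proof (rule poly_eqI)
  fix k
  have 1: "of_nat (Suc n) * of_nat (n choose k) = (of_nat (Suc k) * of_nat (Suc n choose Suc k) :: complex)"
    by (simp only: of_nat_mult[symmetric] Suc_times_binomial_eq mult.commute)
  have 2: "of_nat (Suc n choose k) * (of_nat (Suc n) - of_nat k) = (of_nat (Suc n) * of_nat (n choose k) :: complex)"
  proof (cases "k \<le> Suc n")
    case True
    then have "of_nat (Suc n) - of_nat k = (of_nat (Suc n - k) :: complex)" by (simp add: of_nat_diff)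
    moreover have "(Suc n choose k) * (Suc n - k) = Suc n * (n choose k)"
      using binomial_absorb_comp[of "Suc n" k] by (simp add: mult.commute)
    ultimately show ?thesis by (metis of_nat_mult)
  qed (simp add: binomial_eq_0)
  have "coeff (smult (of_nat (Suc n)) (binomial_poly (Suc n) a) + [:w, -1:] * pderiv (binomial_poly (Suc n) a)) k
     = (of_nat (Suc n) - of_nat k) * of_nat (Suc n choose k) * a k + w * (of_nat (Suc k) * of_nat (Suc n choose Suc k)) * a (Suc k)"
    by (cases k) (simp_all add: coeff_pderiv algebra_simps del: binomial_Suc_Suc of_nat_Suc)
  also have "\<dots> = of_nat (Suc n) * of_nat (n choose k) * (a k + w * a (Suc k))"
    by (subst 1[symmetric], subst mult.commute[of "of_nat (Suc n) - of_nat k"], subst 2) (simp add: algebra_simps)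
  finally show "coeff (smult (of_nat (Suc n)) (binomial_poly n (\<lambda>k. a k + w * a (Suc k)))) k
    = coeff (smult (of_nat (Suc n)) (binomial_poly (Suc n) a) + [:w, -1:] * pderiv (binomial_poly (Suc n) a)) k"
    by (simp only: coeff_smult coeff_binomial_poly mult.assoc)
qed

text \<open>Removing a factor \<open>t + x\<close> from the product replaces \<open>a\<^sub>k\<close> by
  \<open>t a\<^sub>k + z a\<^sub>k\<^sub>+\<^sub>1 = t (a\<^sub>k + (z/t) a\<^sub>k\<^sub>+\<^sub>1)\<close>, which up to the factor \<open>t\<close> is a polar derivative with pole
  \<open>z/t\<close> in the upper half-plane.  Laguerre's theorem thus carries the hypothesis through the induction.\<close>

lemma schur_szego_nonzero:
  fixes a :: "nat \<Rightarrow> complex" and B :: "real multiset"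
  assumes "\<forall>t\<in>#B. t > 0" "Im z > 0"
    and "\<And>x. Im x > 0 \<Longrightarrow> poly (binomial_poly (size B) a) x \<noteq> 0"
  shows "(\<Sum>k\<le>size B. a k * coeff (\<Prod>t\<in>#B. [:of_real t, 1:]) k * z ^ k) \<noteq> 0"
  using assms(1,3)
proof (induction B arbitrary: a)
  case empty
  from empty(2)[of \<i>] show ?case by (simp add: binomial_poly_def poly_monom)
next
  case (add t B)
  have t: "t > 0" using add.prems by simp
  define n where "n = size B"
  define w where "w = z / of_real t"
  have w: "Im w > 0" using t assms(2) by (simp add: w_def)
  define g where "g = (\<Prod>t\<in>#B. [:complex_of_real t, 1:])"
  have dg: "coeff g (Suc n) = 0"
    by (rule coeff_eq_0) (simp add: g_def degree_prod_linear n_def)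
  define b where "b = (\<lambda>k. a k + w * a (Suc k))"
  have "poly (binomial_poly n b) x \<noteq> 0" if x: "Im x > 0" for x
  proof -
    have "of_nat (Suc n) * poly (binomial_poly n b) x
        = of_nat (Suc n) * poly (binomial_poly (Suc n) a) x
          + (w - x) * poly (pderiv (binomial_poly (Suc n) a)) x"
      using arg_cong[OF polar_derivative_binomial_poly[of n a w], of "\<lambda>p. poly p x"]
      by (simp add: b_def algebra_simps)
    also have "\<dots> \<noteq> 0"
      using add.prems(2) w x degree_binomial_poly_le[of "Suc n" a]
      by (intro polar_derivative_nonzero) (auto simp: n_def)
    finally show ?thesis by auto
  qed
  then have "(\<Sum>k\<le>n. b k * coeff g k * z ^ k) \<noteq> 0"
    using add.IH[of b] add.prems by (simp add: n_def g_def)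
  moreover have "(\<Sum>k\<le>Suc n. a k * coeff ([:of_real t, 1:] * g) k * z ^ k)
     = of_real t * (\<Sum>k\<le>n. b k * coeff g k * z ^ k)"
  proof -
    have "(\<Sum>k\<le>Suc n. a k * coeff ([:of_real t, 1:] * g) k * z ^ k)
       = (\<Sum>k\<le>Suc n. of_real t * a k * coeff g k * z ^ k)
         + (\<Sum>k\<le>Suc n. a k * coeff (pCons 0 g) k * z ^ k)"
      by (simp add: sum.distrib[symmetric] algebra_simps del: sum.atMost_Suc)
    also have "(\<Sum>k\<le>Suc n. of_real t * a k * coeff g k * z ^ k) = (\<Sum>k\<le>n. of_real t * a k * coeff g k * z ^ k)"
      using dg by simp
    also have "(\<Sum>k\<le>Suc n. a k * coeff (pCons 0 g) k * z ^ k) = (\<Sum>k\<le>n. a (Suc k) * coeff g k * z ^ Suc k)"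
      by (subst sum.atMost_Suc_shift) simp
    also have "(\<Sum>k\<le>n. of_real t * a k * coeff g k * z ^ k) + \<dots>
        = (\<Sum>k\<le>n. of_real t * (b k * coeff g k * z ^ k))"
      using t by (simp add: sum.distrib[symmetric] b_def w_def algebra_simps)
    also have "\<dots> = of_real t * (\<Sum>k\<le>n. b k * coeff g k * z ^ k)"
      by (simp add: sum_distrib_left)
    finally show ?thesis .
  qed
  ultimately show ?case using t by (simp add: n_def g_def del: sum.atMost_Suc)
qed

section \<open>Diagonal operators\<close>

lemma poly_eq_sum_atMost:
  "degree p \<le> n \<Longrightarrow> poly p (x :: 'a :: comm_semiring_1) = (\<Sum>k\<le>n. coeff p k * x ^ k)"
  by (subst poly_as_sum_of_monoms'[symmetric]) (simp_all add: poly_sum poly_monom)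

lemma size_proots_only_real_zeros:
  assumes "only_real_zeros p"
  shows "size (proots p) = degree p"
proof -
  have "p \<noteq> 0" using assms by (rule only_real_zeros_imp_nonzero)
  then show ?thesis
    using arg_cong[OF only_real_zeros_factorization[OF assms], of degree]
      degree_prod_linear[of uminus "proots p"] by simp
qed

definition diag_op :: "(nat \<Rightarrow> real) \<Rightarrow> real poly \<Rightarrow> real poly" where
  "diag_op \<gamma> p = (\<Sum>k\<le>degree p. monom (\<gamma> k * coeff p k) k)"

lemma coeff_diag_op [simp]: "coeff (diag_op \<gamma> p) k = \<gamma> k * coeff p k"
  by (simp add: diag_op_def coeff_sum sum.delta coeff_eq_0)

lemma diag_op_smult: "diag_op \<gamma> (smult c p) = smult c (diag_op \<gamma> p)"
  by (rule poly_eqI) simp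

lemma degree_diag_op_le: "degree (diag_op \<gamma> p) \<le> degree p"
  by (rule degree_le) (simp add: coeff_eq_0)

lemma poly_binomial_poly_pos:
  fixes \<gamma> :: "nat \<Rightarrow> real"
  assumes "\<And>k. \<gamma> k > 0" "x \<ge> 0"
  shows "poly (binomial_poly n \<gamma>) x > 0"
proof -
  have "poly (binomial_poly n \<gamma>) x = (\<Sum>k\<le>n. of_nat (n choose k) * \<gamma> k * x ^ k)"
    by (simp add: binomial_poly_def poly_sum poly_monom)
  also have "\<dots> > 0"
    by (rule sum_pos2[of _ 0]) (use assms in \<open>auto simp: less_imp_le\<close>)
  finally show ?thesis .
qed

text \<open>Positivity of \<open>\<gamma>\<close> makes the zeros of the Jensen polynomial negative, so that polynomial is a constant times
  a product of factors \<open>t + x\<close> with \<open>t > 0\<close>.  With \<open>a\<^sub>k = p\<^sub>k / (n choose k)\<close> the composition theorem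
  applies; it is enough that \<open>n\<close> is a formal degree of \<open>p\<close>, so a single \<open>n\<close> covers all lower
  degrees.\<close>

lemma only_real_zeros_diag_op:
  assumes pos: "\<And>k. \<gamma> k > 0"
    and g: "only_real_zeros (binomial_poly n \<gamma>)"
    and p: "only_real_zeros p" "degree p \<le> n"
  shows "only_real_zeros (diag_op \<gamma> p)"
  unfolding only_real_zeros_iff_upper_half_plane
proof (intro allI impI)
  fix z :: complex assume z: "Im z > 0"
  define G where "G = binomial_poly n \<gamma>"
  have "coeff G n \<noteq> 0" using pos[of n] by (simp add: G_def)
  then have dG: "degree G = n"
    using le_degree degree_binomial_poly_le unfolding G_def by (metis antisym)
  have G0: "G \<noteq> 0" using \<open>coeff G n \<noteq> 0\<close> by auto
  define B where "B = image_mset uminus (proots G)"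
  have sB: "size B = n"
    using g dG by (simp add: B_def G_def size_proots_only_real_zeros)
  have B: "\<forall>t\<in>#B. t > 0"
  proof
    fix t assume "t \<in># B"
    then have "poly G (- t) = 0" using G0 by (auto simp: B_def)
    then show "t > 0"
      using poly_binomial_poly_pos[of \<gamma> "- t" n] pos by (force simp: G_def not_less[symmetric])
  qed
  define c where "c = complex_of_real (lead_coeff G)"
  have c: "c \<noteq> 0" using G0 by (simp add: c_def)
  have "cpoly G = smult c (\<Prod>r\<in>#proots G. [:- of_real r, 1:])"
    by (subst only_real_zeros_factorization[OF g[folded G_def]]) (simp add: cpoly_prod_linear c_def)
  then have cG: "cpoly G = smult c (\<Prod>t\<in>#B. [:of_real t, 1:])"
    by (simp add: B_def image_mset.compositionality comp_def)
  define a where "a = (\<lambda>k. complex_of_real (coeff p k) / of_nat (n choose k))"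
  have a: "of_nat (n choose k) * a k = of_real (coeff p k)" for k
    using p(2) by (cases "k \<le> n") (simp_all add: a_def coeff_eq_0)
  have bp: "binomial_poly n a = cpoly p"
    by (rule poly_eqI) (simp only: coeff_binomial_poly a coeff_map_poly of_real_0)
  have "(\<Sum>k\<le>n. a k * coeff (\<Prod>t\<in>#B. [:complex_of_real t, 1:]) k * z ^ k) \<noteq> 0"
    using schur_szego_nonzero[OF B z, of a] p(1)
    by (simp add: sB bp only_real_zeros_iff_upper_half_plane)
  moreover have "poly (cpoly (diag_op \<gamma> p)) z
      = c * (\<Sum>k\<le>n. a k * coeff (\<Prod>t\<in>#B. [:complex_of_real t, 1:]) k * z ^ k)"
  proof -
    have "degree (cpoly (diag_op \<gamma> p)) \<le> n"
      using degree_diag_op_le[of \<gamma> p] p(2) by (simp add: degree_map_poly)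
    then have "poly (cpoly (diag_op \<gamma> p)) z = (\<Sum>k\<le>n. of_real (\<gamma> k * coeff p k) * z ^ k)"
      by (simp add: poly_eq_sum_atMost coeff_map_poly)
    also have "\<dots> = (\<Sum>k\<le>n. c * (a k * coeff (\<Prod>t\<in>#B. [:complex_of_real t, 1:]) k * z ^ k))"
    proof (rule sum.cong)
      fix k
      have "c * coeff (\<Prod>t\<in>#B. [:complex_of_real t, 1:]) k = of_nat (n choose k) * of_real (\<gamma> k)"
        using arg_cong[OF cG, of "\<lambda>p. coeff p k"] by (simp add: coeff_map_poly G_def)
      then show "of_real (\<gamma> k * coeff p k) * z ^ k
          = c * (a k * coeff (\<Prod>t\<in>#B. [:complex_of_real t, 1:]) k * z ^ k)"
        using a[of k] by (metis (no_types, lifting) mult.assoc mult.commute of_real_mult)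
    qed simp
    finally show ?thesis by (simp add: sum_distrib_left)
  qed
  ultimately show "poly (cpoly (diag_op \<gamma> p)) z \<noteq> 0" using c by simp
qed

section \<open>Laguerre polynomials as Jensen polynomials\<close>

text \<open>The Rodrigues-type recurrence \<open>(n+1) L\<^sub>n\<^sub>+\<^sub>1^\<alpha> = (1+\<alpha>-x) q + x q'\<close>, where
  \<open>q = L\<^sub>n^(\<alpha>+1)\<close>, in the present normalisation and with \<open>x\<close> replaced by \<open>-x\<close>.\<close>

lemma laguerre_raising:
  fixes \<alpha> :: real and n :: nat
  assumes "\<alpha> > -1"
  defines "q \<equiv> binomial_poly n (\<lambda>k. 1 / pochhammer (2 + \<alpha>) k)"
  shows "smult (1 + \<alpha>) (binomial_poly (Suc n) (\<lambda>k. 1 / pochhammer (1 + \<alpha>) k))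
       = smult (1 + \<alpha>) q + [:0, 1:] * (pderiv q + q)"
proof (rule poly_eqI)
  fix k
  show "coeff (smult (1 + \<alpha>) (binomial_poly (Suc n) (\<lambda>k. 1 / pochhammer (1 + \<alpha>) k))) k
      = coeff (smult (1 + \<alpha>) q + [:0, 1:] * (pderiv q + q)) k"
  proof (cases k)
    case (Suc j)
    define P where "P = pochhammer (2 + \<alpha>) j"
    have P: "P \<noteq> 0" using assms(1) pochhammer_pos[of "2 + \<alpha>" j] by (simp add: P_def)
    have 1: "pochhammer (1 + \<alpha>) (Suc j) = (1 + \<alpha>) * P"
      by (simp add: pochhammer_rec P_def add.commute[of \<alpha>] add.assoc)
    have 2: "pochhammer (2 + \<alpha>) (Suc j) = P * (2 + \<alpha> + real j)"
      by (simp add: pochhammer_Suc P_def)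
    have nz: "1 + \<alpha> \<noteq> 0" "2 + \<alpha> + real j \<noteq> 0" using assms(1) by linarith+
    have "coeff (smult (1 + \<alpha>) (binomial_poly (Suc n) (\<lambda>k. 1 / pochhammer (1 + \<alpha>) k))) k
      = (real (n choose j) + real (n choose Suc j)) / P"
      using nz(1) unfolding Suc coeff_smult coeff_binomial_poly 1 by simp
    moreover have "coeff (smult (1 + \<alpha>) q + [:0, 1:] * (pderiv q + q)) k
      = real (n choose Suc j) / P + real (n choose j) / P"
    proof -
      have "coeff (smult (1 + \<alpha>) q + [:0, 1:] * (pderiv q + q)) k
        = (2 + \<alpha> + real j) * coeff q (Suc j) + coeff q j"
        unfolding Suc by (simp add: coeff_pderiv algebra_simps)
      then show ?thesis unfolding q_def coeff_binomial_poly 2 P_def[symmetric] using nz(2) by simp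
    qed
    ultimately show ?thesis by (simp only: add_divide_distrib add.commute)
  qed (simp add: q_def)
qed

text \<open>The recurrence presents the polynomial as a multiple of \<open>z q ((1+\<alpha>)/z + q'/q + 1)\<close>, and the bracket has
  negative imaginary part in the upper half-plane.\<close>

lemma only_real_zeros_laguerre_jensen:
  "\<alpha> > -1 \<Longrightarrow> only_real_zeros (binomial_poly n (\<lambda>k. 1 / pochhammer (1 + \<alpha>) k))"
proof (induction n arbitrary: \<alpha>)
  case 0
  then show ?case by (simp add: binomial_poly_def only_real_zeros_def monom_0)
next
  case (Suc n)
  define q where "q = binomial_poly n (\<lambda>k. 1 / pochhammer (2 + \<alpha>) k)"
  have q: "only_real_zeros q"
    using Suc.IH[of "1 + \<alpha>"] Suc.prems by (simp add: q_def add.assoc[symmetric])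
  have "poly (cpoly (binomial_poly (Suc n) (\<lambda>k. 1 / pochhammer (1 + \<alpha>) k))) z \<noteq> 0"
    if z: "Im z > 0" for z
  proof -
    define S where "S = (\<Sum>r\<in>#proots q. 1 / (z - complex_of_real r))"
    have "Im S \<le> 0" unfolding S_def by (rule Im_log_derivative_nonpos[OF z])
    have "Im (of_real (1 + \<alpha>) / z) < 0"
      using z Suc.prems by (simp add: Im_divide divide_neg_pos sum_power2_gt_zero_iff)
    with \<open>Im S \<le> 0\<close> have "Im (of_real (1 + \<alpha>) / z + S + 1) < 0"
      by simp
    then have nz: "of_real (1 + \<alpha>) / z + S + 1 \<noteq> 0" by (metis less_irrefl zero_complex.sel(2))
    have z0: "z \<noteq> 0" using z by auto
    have "of_real (1 + \<alpha>) * poly (cpoly (binomial_poly (Suc n) (\<lambda>k. 1 / pochhammer (1 + \<alpha>) k))) z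
      = of_real (1 + \<alpha>) * poly (cpoly q) z + z * (poly (cpoly (pderiv q)) z + poly (cpoly q) z)"
      using arg_cong[OF laguerre_raising[OF Suc.prems, of n], of "\<lambda>p. poly (cpoly p) z"]
      unfolding q_def[symmetric] by (simp only: cpoly_add cpoly_smult cpoly_mult cpoly_pCons poly_smult poly_add poly_mult) simp
    also have "\<dots> = z * poly (cpoly q) z * (of_real (1 + \<alpha>) / z + S + 1)"
      using z0 unfolding only_real_zeros_log_derivative[OF q z] S_def[symmetric]
      by (simp add: field_simps)
    finally show ?thesis
      using nz z0 q z by (auto simp: only_real_zeros_iff_upper_half_plane)
  qed
  then show ?case by (simp add: only_real_zeros_iff_upper_half_plane)
qed

section \<open>Jacobi polynomials as Jensen polynomials\<close>

text \<open>The polynomial \<^term>\<open>binomial_poly n c\<close> is the hypergeometric polynomial \<open>\<^sub>2F\<^sub>1(-n, 1+\<alpha>; 1; -x)\<close>, a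
  Jacobi polynomial with parameters \<open>0\<close> and \<open>\<alpha>-n\<close> in the variable \<open>1+2x\<close>.  The identity is the relation
  between contiguous functions that raises the degree while keeping \<open>\<alpha>\<close>.\<close>

lemma jacobi_raising:
  fixes \<alpha> :: real
  defines "c \<equiv> (\<lambda>k. pochhammer (1 + \<alpha>) k / fact k)"
  shows "smult (real (Suc n)) (binomial_poly (Suc n) c)
       = [:0, 1, 1:] * pderiv (binomial_poly n c) + [:real (Suc n), 1 + \<alpha>:] * binomial_poly n c"
proof (rule poly_eqI)
  fix k
  show "coeff (smult (real (Suc n)) (binomial_poly (Suc n) c)) k
      = coeff ([:0, 1, 1:] * pderiv (binomial_poly n c) + [:real (Suc n), 1 + \<alpha>:] * binomial_poly n c) k"
  proof (cases k)
    case (Suc j)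
    have c: "(1 + \<alpha> + real j) * c j = (1 + real j) * c (Suc j)"
    proof -
      have "1 + real j \<noteq> 0" by linarith
      then show ?thesis unfolding c_def pochhammer_Suc fact_Suc of_nat_Suc by simp
    qed
    have b: "real (Suc j) * real (n choose Suc j) = (real n - real j) * real (n choose j)"
    proof (cases "j \<le> n")
      case True
      have "Suc j * (n choose Suc j) = (n - j) * (n choose j)"
        by (simp only: binomial_absorption binomial_absorb_comp)
      then show ?thesis using True by (metis of_nat_diff of_nat_mult)
    qed (simp add: binomial_eq_0)
    have "coeff ([:0, 1, 1:] * pderiv (binomial_poly n c) + [:real (Suc n), 1 + \<alpha>:] * binomial_poly n c) k
      = real (Suc j) * real (n choose Suc j) * c (Suc j) + real (Suc n) * real (n choose Suc j) * c (Suc j)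
        + real (n choose j) * ((1 + \<alpha> + real j) * c j)"
      unfolding Suc by (cases j) (simp_all add: coeff_pderiv algebra_simps)
    also have "\<dots> = c (Suc j) * ((real n - real j) * real (n choose j)
        + real (Suc n) * real (n choose Suc j) + (1 + real j) * real (n choose j))"
      unfolding b c by (simp add: algebra_simps)
    finally show ?thesis unfolding Suc by (simp add: algebra_simps)
  qed (simp add: c_def)
qed

text \<open>Up to the factor \<open>n+1\<close>, the recurrence presents the new polynomial as
  \<open>q (z(1+z) q'/q + (n+1) + (1+\<alpha>) z)\<close>.  By division,
  \<open>z(1+z)/(z-r) = z + 1 + r + r(1+r)/(z-r)\<close>, and \<open>r(1+r) \<le> 0\<close> precisely because \<open>r\<close> lies in
  \<open>[-1,0]\<close>; hence every term of the bracket has nonnegative imaginary part, and the last one is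
  positive.\<close>

lemma only_real_zeros_jacobi_step:
  fixes \<alpha> :: real
  defines "c \<equiv> (\<lambda>k. pochhammer (1 + \<alpha>) k / fact k)"
  assumes \<alpha>: "\<alpha> > -1" and q: "only_real_zeros (binomial_poly n c)"
    and roots: "\<And>r. poly (binomial_poly n c) r = 0 \<Longrightarrow> -1 \<le> r \<and> r \<le> 0"
  shows "only_real_zeros (binomial_poly (Suc n) c)"
  unfolding only_real_zeros_iff_upper_half_plane
proof (intro allI impI)
  fix z :: complex assume z: "Im z > 0"
  let ?q = "binomial_poly n c"
  have q0: "?q \<noteq> 0" using q by (rule only_real_zeros_imp_nonzero)
  define S where "S = (\<Sum>r\<in>#proots ?q. 1 / (z - complex_of_real r))"
  have summand: "Im (z * (1 + z) * (1 / (z - of_real r))) \<ge> 0" if "-1 \<le> r" "r \<le> 0" for r :: real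
  proof -
    have "z - of_real r \<noteq> 0" using z by auto
    then have "z * (1 + z) * (1 / (z - of_real r)) = z + of_real (1 + r) + of_real (r * (1 + r)) * (1 / (z - of_real r))"
      by (simp add: field_simps)
    then have "Im (z * (1 + z) * (1 / (z - of_real r))) = Im z + r * (1 + r) * Im (1 / (z - of_real r))"
      by (simp only: plus_complex.sel times_complex.sel Im_complex_of_real Re_complex_of_real)
    moreover have "Im (1 / (z - of_real r)) < 0" using z by (intro Im_inverse_neg) simp
    moreover have "r * (1 + r) \<le> 0" using that by (simp add: mult_nonpos_nonneg)
    ultimately show ?thesis using z mult_nonpos_nonpos[of "r * (1 + r)" "Im (1 / (z - of_real r))"] by linarith
  qed
  have "Im (z * (1 + z) * S) = (\<Sum>r\<in>#proots ?q. Im (z * (1 + z) * (1 / (z - of_real r))))"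
    unfolding S_def sum_mset_distrib_left Im_sum_mset ..
  also have "\<dots> \<ge> 0"
    using roots q0 summand by (intro sum_mset_real_nonneg) auto
  moreover have "Im (of_nat (Suc n) + of_real (1 + \<alpha>) * z) > 0" using z \<alpha> by simp
  ultimately have "Im (z * (1 + z) * S + (of_nat (Suc n) + of_real (1 + \<alpha>) * z)) > 0"
    by simp
  then have nz: "z * (1 + z) * S + (of_nat (Suc n) + of_real (1 + \<alpha>) * z) \<noteq> 0"
    by (metis less_irrefl zero_complex.sel(2))
  have "of_nat (Suc n) * poly (cpoly (binomial_poly (Suc n) c)) z
     = z * (1 + z) * poly (cpoly (pderiv ?q)) z + (of_nat (Suc n) + of_real (1 + \<alpha>) * z) * poly (cpoly ?q) z"
    using arg_cong[OF jacobi_raising[of n \<alpha>, folded c_def], of "\<lambda>p. poly (cpoly p) z"]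
    by (simp only: cpoly_add cpoly_smult cpoly_mult cpoly_pCons poly_smult poly_add poly_mult) (simp add: algebra_simps)
  also have "\<dots> = poly (cpoly ?q) z * (z * (1 + z) * S + (of_nat (Suc n) + of_real (1 + \<alpha>) * z))"
    unfolding only_real_zeros_log_derivative[OF q z] S_def[symmetric] by (simp add: algebra_simps)
  finally show "poly (cpoly (binomial_poly (Suc n) c)) z \<noteq> 0"
    using nz q z by (auto simp: only_real_zeros_iff_upper_half_plane)
qed

text \<open>Positive coefficients exclude positive zeros.  For \<open>x < -1\<close> the recurrence, divided by
  \<open>q\<close>, gives \<open>x(1+x) q'/q + (n+1) + (1+\<alpha>) x\<close>: the first term is nonpositive, since all zeros of \<open>q\<close> are to
  the right of \<open>x\<close>, and the rest is less than \<open>n - \<alpha>\<close>, which is negative when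
  the new degree \<open>n+1\<close> satisfies the hypothesis.\<close>

lemma jacobi_zeros_in_unit_interval:
  fixes \<alpha> :: real
  defines "c \<equiv> (\<lambda>k. pochhammer (1 + \<alpha>) k / fact k)"
  assumes "\<alpha> > -1" "\<alpha> > real n - 1"
  shows "only_real_zeros (binomial_poly n c) \<and> (\<forall>r. poly (binomial_poly n c) r = 0 \<longrightarrow> -1 \<le> r \<and> r \<le> 0)"
  using assms(3)
proof (induction n)
  case 0
  then show ?case by (simp add: binomial_poly_def only_real_zeros_def c_def monom_0)
next
  case (Suc n)
  let ?q = "binomial_poly n c"
  from Suc have q: "only_real_zeros ?q" and r: "\<And>r. poly ?q r = 0 \<Longrightarrow> -1 \<le> r \<and> r \<le> 0"
    by simp_all
  have q0: "?q \<noteq> 0" using q by (rule only_real_zeros_imp_nonzero)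
  have pos: "c k > 0" for k using assms(2) by (simp add: c_def pochhammer_pos)
  have "-1 \<le> x \<and> x \<le> 0" if x: "poly (binomial_poly (Suc n) c) x = 0" for x
  proof (rule ccontr)
    assume "\<not> ?thesis"
    moreover have "\<not> x > 0" using poly_binomial_poly_pos[of c x "Suc n"] pos x by auto
    ultimately have x1: "x < -1" by simp
    then have qx: "poly ?q x \<noteq> 0" using r[of x] by auto
    define S where "S = (\<Sum>r\<in>#proots ?q. 1 / (x - r))"
    have "poly (pderiv ?q) x = poly ?q x * S"
      unfolding S_def by (rule poly_pderiv_eq_sum_roots[OF only_real_zeros_factorization[OF q] qx])
    moreover have "S \<le> 0"
      unfolding S_def
    proof (rule sum_mset_real_nonpos)
      fix s assume "s \<in># proots ?q"
      then have "-1 \<le> s" using r q0 by simp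
      then show "1 / (x - s) \<le> 0" using x1 by simp
    qed
    moreover have "x * (1 + x) > 0" using x1 by (simp add: mult_neg_neg)
    moreover have "real (Suc n) + (1 + \<alpha>) * x < 0"
    proof -
      have "(1 + \<alpha>) * x < (1 + \<alpha>) * (-1)" using x1 assms(2) by (intro mult_strict_left_mono) auto
      then show ?thesis using Suc.prems by simp
    qed
    ultimately have "x * (1 + x) * S + (real (Suc n) + (1 + \<alpha>) * x) < 0"
      using mult_nonneg_nonpos[of "x * (1 + x)" S] by linarith
    moreover have "real (Suc n) * poly (binomial_poly (Suc n) c) x
        = poly ?q x * (x * (1 + x) * S + (real (Suc n) + (1 + \<alpha>) * x))"
      using arg_cong[OF jacobi_raising[of n \<alpha>, folded c_def], of "\<lambda>p. poly p x"]
        \<open>poly (pderiv ?q) x = poly ?q x * S\<close>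
      by (simp only: poly_smult poly_add poly_mult) (simp add: algebra_simps)
    ultimately show False using qx x by simp
  qed
  moreover have "only_real_zeros (binomial_poly (Suc n) c)"
    using only_real_zeros_jacobi_step[of \<alpha> n] assms(2) q r unfolding c_def by blast
  ultimately show ?case by blast
qed

text \<open>The last step needs the location of the zeros only one degree lower, which relaxes the bound from
  \<open>n - 1\<close> to \<open>n - 2\<close>.  Some zero may then lie to the left of \<open>-1\<close>.\<close>

corollary only_real_zeros_jacobi:
  fixes \<alpha> :: real
  assumes "\<alpha> > -1" "\<alpha> > real n - 2"
  shows "only_real_zeros (binomial_poly n (\<lambda>k. pochhammer (1 + \<alpha>) k / fact k))"
proof (cases n)
  case 0
  then show ?thesis by (simp add: binomial_poly_def only_real_zeros_def monom_0)
next
  case (Suc m)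
  with jacobi_zeros_in_unit_interval[of \<alpha> m] only_real_zeros_jacobi_step[of \<alpha> m] assms
  show ?thesis by simp
qed

section \<open>Natural parameters\<close>

text \<open>This operator is \<open>p \<mapsto> c p + x p'\<close>, that is \<open>x p (c/x + p'/p)\<close>.\<close>

lemma only_real_zeros_euler:
  assumes "c > 0" "only_real_zeros p"
  shows "only_real_zeros (diag_op (\<lambda>k. c + real k) p)"
  unfolding only_real_zeros_iff_upper_half_plane
proof (intro allI impI)
  fix z :: complex assume z: "Im z > 0"
  then have z0: "z \<noteq> 0" by auto
  have eq: "diag_op (\<lambda>k. c + real k) p = smult c p + [:0, 1:] * pderiv p"
    by (rule poly_eqI) (simp add: coeff_pderiv coeff_pCons algebra_simps split: nat.splits)
  define S where "S = (\<Sum>r\<in>#proots p. 1 / (z - complex_of_real r))"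
  have "Im S \<le> 0" unfolding S_def by (rule Im_log_derivative_nonpos[OF z])
  moreover have "Im (of_real c / z) < 0"
    using z assms(1) by (simp add: Im_divide divide_neg_pos sum_power2_gt_zero_iff)
  ultimately have "Im (of_real c / z + S) < 0" by simp
  then have nz: "of_real c / z + S \<noteq> 0" by (metis less_irrefl zero_complex.sel(2))
  have "poly (cpoly (diag_op (\<lambda>k. c + real k) p)) z = z * poly (cpoly p) z * (of_real c / z + S)"
    unfolding eq using z0 only_real_zeros_log_derivative[OF assms(2) z]
    by (simp add: S_def field_simps del: mult_pCons_left)
  then show "poly (cpoly (diag_op (\<lambda>k. c + real k) p)) z \<noteq> 0"
    using nz z0 assms(2) z by (auto simp: only_real_zeros_iff_upper_half_plane)
qed

text \<open>Raising \<open>m\<close> by one multiplies the entries by \<open>(1+m+k)/(1+m)\<close>.\<close>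

lemma only_real_zeros_diag_op_nat:
  assumes "only_real_zeros p"
  shows "only_real_zeros (diag_op (\<lambda>k. pochhammer (1 + real m) k / fact k) p)"
proof (induction m)
  case 0
  have "diag_op (\<lambda>k. pochhammer (1 + real 0) k / fact k) p = p"
    by (rule poly_eqI) (simp add: pochhammer_fact[symmetric])
  then show ?case using assms by simp
next
  case (Suc m)
  have "diag_op (\<lambda>k. pochhammer (1 + real (Suc m)) k / fact k) p
    = smult (1 / (1 + real m))
        (diag_op (\<lambda>k. 1 + real m + real k) (diag_op (\<lambda>k. pochhammer (1 + real m) k / fact k) p))"
  proof (rule poly_eqI)
    fix k
    have "(1 + real m) * pochhammer (1 + real (Suc m)) k = pochhammer (1 + real m) k * (1 + real m + real k)"
      using pochhammer_rec[of "1 + real m" k] pochhammer_Suc[of "1 + real m" k] by (simp add: add.commute add.left_commute)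
    then have "pochhammer (1 + real (Suc m)) k = pochhammer (1 + real m) k * (1 + real m + real k) / (1 + real m)"
      by (simp add: eq_divide_eq mult.commute)
    then show "coeff (diag_op (\<lambda>k. pochhammer (1 + real (Suc m)) k / fact k) p) k = coeff (smult (1 / (1 + real m))
        (diag_op (\<lambda>k. 1 + real m + real k) (diag_op (\<lambda>k. pochhammer (1 + real m) k / fact k) p))) k"
      by (simp only: coeff_diag_op coeff_smult times_divide_eq_left times_divide_eq_right
            divide_divide_eq_left mult_ac mult_1)
  qed
  then show ?case
    using only_real_zeros_euler[OF _ Suc, of "1 + real m"] by (simp add: only_real_zeros_smult)
qed

section \<open>The operators with Laguerre images\<close>

lemma coeff_laguerre:
  "coeff (laguerre \<alpha> n) j
     = (if j \<le> n then ((real n + \<alpha>) gchoose (n - j)) / fact j * (- 1) ^ j else 0)"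
proof -
  have "[:0, -1:] ^ i = (monom ((- 1) ^ i) i :: real poly)" for i :: nat
    by (induction i) (simp_all add: monom_Suc monom_0 smult_monom)
  then show ?thesis
    by (simp add: laguerre_def coeff_sum sum.delta if_distrib cong: if_cong)
qed

lemma laguerre_diff: "laguerre \<alpha> (Suc n) - laguerre \<alpha> n = laguerre (\<alpha> - 1) (Suc n)"
proof (rule poly_eqI)
  fix j
  consider "j \<le> n" | "j = Suc n" | "j > Suc n" by linarith
  then show "coeff (laguerre \<alpha> (Suc n) - laguerre \<alpha> n) j = coeff (laguerre (\<alpha> - 1) (Suc n)) j"
  proof cases
    case 1
    then have "Suc n - j = Suc (n - j)" by simp
    with gbinomial_Suc_Suc[of "real n + \<alpha>" "n - j"] 1 show ?thesis
      by (simp add: coeff_laguerre algebra_simps add_divide_distrib)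
  qed (simp_all add: coeff_laguerre)
qed

lemma laguerre_eq_smult_cal:
  assumes "\<alpha> > -1"
  shows "laguerre \<alpha> n = smult (pochhammer (1 + \<alpha>) n / fact n) (laguerre_cal \<alpha> n)"
  using pochhammer_pos[of "1 + \<alpha>" n] assms by (simp add: laguerre_cal_def)

lemma laguerre_cal_eq_diag_op:
  assumes "\<alpha> > -1"
  shows "laguerre_cal \<alpha> n
       = pcompose (diag_op (\<lambda>k. 1 / pochhammer (1 + \<alpha>) k) ([:1, 1:] ^ n)) [:0, -1:]"
proof (rule poly_eqI)
  fix j
  show "coeff (laguerre_cal \<alpha> n) j
       = coeff (pcompose (diag_op (\<lambda>k. 1 / pochhammer (1 + \<alpha>) k) ([:1, 1:] ^ n)) [:0, -1:]) j"
  proof (cases "j \<le> n")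
    case True
    define P Q where "P = pochhammer (1 + \<alpha>) j" and "Q = pochhammer (1 + \<alpha> + real j) (n - j)"
    have nz: "P \<noteq> 0" "Q \<noteq> 0"
      using assms pochhammer_pos[of "1 + \<alpha>" j] pochhammer_pos[of "1 + \<alpha> + real j" "n - j"]
      by (simp_all add: P_def Q_def)
    have 1: "pochhammer (1 + \<alpha>) n = P * Q"
      unfolding P_def Q_def by (rule pochhammer_product[OF True])
    have 2: "(real n + \<alpha>) gchoose (n - j) = Q / fact (n - j)"
      unfolding gbinomial_pochhammer' Q_def using True by (simp add: of_nat_diff add.commute add.left_commute)
    have 3: "real (n choose j) = fact n / (fact j * fact (n - j))"
      by (rule binomial_fact[OF True])
    show ?thesis
      using True nz
      by (simp add: laguerre_cal_def coeff_laguerre coeff_pcompose_linear coeff_linear_poly_power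
          1 2 3 P_def[symmetric] mult_ac)
  next
    case False
    have "degree ([:1, 1:] ^ n :: real poly) \<le> n"
      using degree_power_le[of "[:1, 1:] :: real poly" n] by simp
    with False show ?thesis
      by (simp add: laguerre_cal_def coeff_laguerre coeff_pcompose_linear coeff_eq_0)
  qed
qed

lemma linear_poly_eq_on_monoms:
  assumes "Vector_Spaces.linear smult smult S" "Vector_Spaces.linear smult smult T"
    and "\<And>n. S (monom 1 n) = (T (monom 1 n) :: 'a :: field poly)"
  shows "S = T"
proof
  fix p
  interpret S: Vector_Spaces.linear smult smult S by fact
  interpret T: Vector_Spaces.linear smult smult T by fact
  have "S (monom (coeff p i) i) = T (monom (coeff p i) i)" for i
    using S.scale[of "coeff p i" "monom 1 i"] T.scale[of "coeff p i" "monom 1 i"] assms(3)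
    by (simp add: smult_monom)
  then have "S (\<Sum>i\<le>degree p. monom (coeff p i) i) = T (\<Sum>i\<le>degree p. monom (coeff p i) i)"
    by (simp add: S.sum T.sum)
  then show "S p = T p" by (simp add: poly_as_sum_of_monoms)
qed

lemma linear_diag_op_pcompose:
  "Vector_Spaces.linear smult smult
     (\<lambda>p. pcompose (diag_op \<sigma> (pcompose (diag_op \<mu> p) q)) r)"
proof -
  have add: "diag_op \<gamma> (p + q) = diag_op \<gamma> p + diag_op \<gamma> q" for \<gamma> p q
    by (rule poly_eqI) (simp add: algebra_simps)
  show ?thesis
    by unfold_locales (simp_all add: add diag_op_smult pcompose_add pcompose_smult smult_add_right smult_add_left)
qed

text \<open>Both sides are linear and agree on monomials, since the shift sends \<open>x^n\<close> to \<open>(1+x)^n\<close>.\<close>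

lemma laguerre_operator_factorization:
  assumes T: "Vector_Spaces.linear smult smult T" and \<alpha>: "\<alpha> > -1"
    and monom: "\<And>n. T (monom 1 n) = smult (\<mu> n) (laguerre_cal \<alpha> n)"
  shows "T p = pcompose (diag_op (\<lambda>k. 1 / pochhammer (1 + \<alpha>) k)
                 (pcompose (diag_op \<mu> p) [:1, 1:])) [:0, -1:]"
proof -
  have "T = (\<lambda>p. pcompose (diag_op (\<lambda>k. 1 / pochhammer (1 + \<alpha>) k)
                 (pcompose (diag_op \<mu> p) [:1, 1:])) [:0, -1:])"
  proof (rule linear_poly_eq_on_monoms[OF T linear_diag_op_pcompose])
    fix n
    have "diag_op \<mu> (monom 1 n) = smult (\<mu> n) (monom 1 n)"
      by (rule poly_eqI) simp
    moreover have "pcompose (monom 1 n) [:1, 1:] = ([:1, 1:] ^ n :: real poly)"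
      by (induction n) (simp_all add: monom_Suc pcompose_pCons monom_0)
    ultimately show "T (monom 1 n) = pcompose (diag_op (\<lambda>k. 1 / pochhammer (1 + \<alpha>) k)
                 (pcompose (diag_op \<mu> (monom 1 n)) [:1, 1:])) [:0, -1:]"
      using laguerre_cal_eq_diag_op[OF \<alpha>, of n] by (simp add: monom pcompose_smult diag_op_smult)
  qed
  then show ?thesis by (rule fun_cong)
qed

lemma only_real_zeros_diag_op_inverse_pochhammer:
  assumes "\<alpha> > -1" "only_real_zeros p"
  shows "only_real_zeros (diag_op (\<lambda>k. 1 / pochhammer (1 + \<alpha>) k) p)"
  using assms only_real_zeros_laguerre_jensen[OF assms(1), of "degree p"]
  by (intro only_real_zeros_diag_op[where n = "degree p"]) (simp_all add: pochhammer_pos)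

lemma only_real_zeros_laguerre_operator:
  assumes "Vector_Spaces.linear smult smult T" "\<alpha> > -1"
    and "\<And>n. T (monom 1 n) = smult (\<mu> n) (laguerre_cal \<alpha> n)"
    and "only_real_zeros (diag_op \<mu> p)"
  shows "only_real_zeros (T p)"
  unfolding laguerre_operator_factorization[OF assms(1-3)]
  using assms(2,4)
  by (intro only_real_zeros_pcompose_linear only_real_zeros_diag_op_inverse_pochhammer) simp_all

text \<open>By the difference identity, multiplying the argument by \<open>x - 1\<close> has the same effect as multiplying it
  by \<open>x\<close> and lowering the parameter by one.\<close>

lemma laguerre_operator_power:
  assumes "Vector_Spaces.linear smult smult T" "\<And>n. T (monom 1 n) = laguerre \<alpha> n"
  shows "T ([:-1, 1:] ^ K * monom 1 m) = laguerre (\<alpha> - real K) (m + K)"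
proof (induction K arbitrary: m)
  case 0
  then show ?case by (simp add: assms(2))
next
  case (Suc K)
  interpret T: Vector_Spaces.linear smult smult T by fact
  have "[:-1, 1:] ^ Suc K * monom 1 m
      = [:-1, 1:] ^ K * monom 1 (Suc m) - [:-1, 1:] ^ K * (monom 1 m :: real poly)"
    by (simp add: monom_Suc algebra_simps)
  then have "T ([:-1, 1:] ^ Suc K * monom 1 m)
      = laguerre (\<alpha> - real K) (Suc m + K) - laguerre (\<alpha> - real K) (m + K)"
    by (simp only: T.diff Suc.IH)
  also have "\<dots> = laguerre (\<alpha> - real K - 1) (Suc (m + K))"
    using laguerre_diff[of "\<alpha> - real K" "m + K"] by simp
  finally show ?case by (simp add: algebra_simps)
qed

text \<open>With \<open>K = m + 2\<close> the lowest coefficients are generalised binomial coefficients of \<open>\<alpha>\<close>, all nonzero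
  because \<open>\<alpha>\<close> is not a natural number.  In terms of \<open>d = m - \<alpha>\<close> Laguerre's inequality reduces to
  \<open>(d+1)/(m+2) \<le> d/(m+1)\<close>, that is \<open>d \<ge> m + 1\<close>, whereas \<open>\<alpha> > -1\<close> means \<open>d < m + 1\<close>.
  The hypothesis \<open>\<alpha> < K - 2\<close> enters as \<open>d > 0\<close>, which fixes the sign of the cancelled factor.\<close>

lemma laguerre_not_only_real_zeros:
  assumes "\<alpha> > -1" "\<alpha> \<notin> \<nat>" "\<alpha> < real K - 2"
  shows "\<not> only_real_zeros (laguerre (\<alpha> - real K) K)"
proof
  assume real: "only_real_zeros (laguerre (\<alpha> - real K) K)"
  obtain m where K: "K = Suc (Suc m)"
    using assms(1,3) by (cases K; cases "K - 1") auto
  define b where "b = \<alpha> gchoose m"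
  define d where "d = real m - \<alpha>"
  have d: "0 < d" "d < real m + 1" using assms K by (simp_all add: d_def)
  have "b \<noteq> 0"
    using assms(2) unfolding b_def by (auto simp: gbinomial_prod_rev prod_zero_iff)
  have s: "real (Suc k) * (\<alpha> gchoose Suc k) = (\<alpha> - real k) * (\<alpha> gchoose k)" for k
    using gbinomial_absorption gbinomial_absorb_comp by metis
  have 1: "\<alpha> gchoose Suc m = - d * b / (real m + 1)"
    using s[of m] by (simp add: b_def d_def field_simps)
  have 2: "\<alpha> gchoose Suc (Suc m) = d * (d + 1) * b / ((real m + 1) * (real m + 2))"
  proof -
    define e where "e = d + 1"
    have "\<alpha> - real (Suc m) = - e" by (simp add: d_def e_def)
    with s[of "Suc m"] have "\<alpha> gchoose Suc (Suc m) = - e * (\<alpha> gchoose Suc m) / real (Suc (Suc m))"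
      by (simp only: eq_divide_eq mult.commute) simp
    then show ?thesis unfolding 1 e_def[symmetric] by (simp add: mult_ac add.commute)
  qed
  have "2 * (\<alpha> gchoose K) * ((\<alpha> gchoose m) / 2) \<le> (- (\<alpha> gchoose Suc m))\<^sup>2"
    using laguerre_inequality[OF real] by (simp add: coeff_laguerre K)
  then have "d * (d + 1) * b / ((real m + 1) * (real m + 2)) * b \<le> (d * b / (real m + 1))\<^sup>2"
    unfolding K 1 2 by (simp add: b_def[symmetric])
  then have "(d + 1) / (real m + 2) * (d * b\<^sup>2 / (real m + 1)) \<le> d / (real m + 1) * (d * b\<^sup>2 / (real m + 1))"
    by (simp add: power2_eq_square mult_ac)
  moreover have "d * b\<^sup>2 / (real m + 1) > 0" using d \<open>b \<noteq> 0\<close> by simp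
  ultimately have "(d + 1) / (real m + 2) \<le> d / (real m + 1)"
    by (simp only: mult_le_cancel_right_pos)
  then show False using d by (simp add: field_simps)
qed

theorem corollary1p7:
  fixes T :: "real poly \<Rightarrow> real poly" and \<alpha> :: real
  assumes "Vector_Spaces.linear smult smult T"
    and "\<alpha> > -1"
  shows "(\<alpha> \<notin> \<nat> \<and> (\<forall>n. T (monom 1 n) = laguerre \<alpha> n) \<longrightarrow>
            (\<forall>K::nat. K > 0 \<longrightarrow> (preserves_real_rootedness_upto K T \<longleftrightarrow> \<alpha> > real K - 2)))
       \<and> (\<alpha> \<in> \<nat> \<and> (\<forall>n. T (monom 1 n) = laguerre \<alpha> n) \<longrightarrow> preserves_real_rootedness T)
       \<and> ((\<forall>n. T (monom 1 n) = laguerre_cal \<alpha> n) \<longrightarrow> preserves_real_rootedness T)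
       \<and> ((\<forall>n. T (monom 1 n) = laguerre_frak \<alpha> n) \<longrightarrow> preserves_real_rootedness T)"
proof (intro conjI impI allI; (elim conjE)?)
  fix K :: nat
  assume \<alpha>: "\<alpha> \<notin> \<nat>" and T: "\<forall>n. T (monom 1 n) = laguerre \<alpha> n" and "K > 0"
  show "preserves_real_rootedness_upto K T \<longleftrightarrow> \<alpha> > real K - 2"
  proof
    assume pres: "preserves_real_rootedness_upto K T"
    show "\<alpha> > real K - 2"
    proof (rule ccontr)
      assume "\<not> ?thesis"
      moreover have "\<alpha> \<noteq> real K - 2"
      proof
        assume "\<alpha> = real K - 2"
        moreover from this have "K \<ge> 2" using assms(2) by linarith
        ultimately have "\<alpha> = real (K - 2)" by simp
        with \<alpha> show False by auto
      qed
      ultimately have "\<alpha> < real K - 2" by simp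
      \<comment> \<open>The counterexample is \<open>(x-1)^K\<close>.\<close>
      have "only_real_zeros [:-1, 1:]" by (simp add: only_real_zeros_def)
      then have "only_real_zeros ([:-1, 1:] ^ K)"
        by (induction K) (simp_all add: only_real_zeros_mult_iff only_real_zeros_def[of 1] del: mult_pCons_left)
      moreover have "degree ([:-1, 1:] ^ K :: real poly) \<le> K"
        using degree_power_le[of "[:-1, 1:] :: real poly" K] by simp
      ultimately have "only_real_zeros (T ([:-1, 1:] ^ K))"
        using pres by (simp add: preserves_real_rootedness_upto_def)
      moreover have "T ([:-1, 1:] ^ K) = laguerre (\<alpha> - real K) K"
        using laguerre_operator_power[OF assms(1), of \<alpha> K 0] T by simp
      ultimately show False
        using laguerre_not_only_real_zeros[OF assms(2) \<alpha> \<open>\<alpha> < real K - 2\<close>] by simp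
    qed
  next
    assume K: "\<alpha> > real K - 2"
    have "only_real_zeros (T p)" if p: "only_real_zeros p" "degree p \<le> K" for p
    proof (rule only_real_zeros_laguerre_operator[OF assms])
      show "T (monom 1 n) = smult (pochhammer (1 + \<alpha>) n / fact n) (laguerre_cal \<alpha> n)" for n
        using T laguerre_eq_smult_cal[OF assms(2)] by simp
      show "only_real_zeros (diag_op (\<lambda>n. pochhammer (1 + \<alpha>) n / fact n) p)"
        using p only_real_zeros_jacobi[OF assms(2) K] assms(2)
        by (intro only_real_zeros_diag_op[where n = K]) (simp_all add: pochhammer_pos)
    qed
    then show "preserves_real_rootedness_upto K T"
      by (simp add: preserves_real_rootedness_upto_def)
  qed
next
  assume "\<alpha> \<in> \<nat>" and T: "\<forall>n. T (monom 1 n) = laguerre \<alpha> n"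
  then obtain m where m: "\<alpha> = real m" by (auto elim: Nats_cases)
  have "only_real_zeros (T p)" if p: "only_real_zeros p" for p
  proof (rule only_real_zeros_laguerre_operator[OF assms])
    show "T (monom 1 n) = smult (pochhammer (1 + \<alpha>) n / fact n) (laguerre_cal \<alpha> n)" for n
      using T laguerre_eq_smult_cal[OF assms(2)] by simp
    show "only_real_zeros (diag_op (\<lambda>n. pochhammer (1 + \<alpha>) n / fact n) p)"
      unfolding m by (rule only_real_zeros_diag_op_nat[OF p])
  qed
  then show "preserves_real_rootedness T"
    by (simp add: preserves_real_rootedness_def preserves_real_rootedness_upto_def)
next
  assume T: "\<forall>n. T (monom 1 n) = laguerre_cal \<alpha> n"
  have "only_real_zeros (T p)" if p: "only_real_zeros p" for p
  proof (rule only_real_zeros_laguerre_operator[OF assms])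
    show "T (monom 1 n) = smult 1 (laguerre_cal \<alpha> n)" for n
      using T by simp
    have "diag_op (\<lambda>n. 1) p = p" by (rule poly_eqI) simp
    then show "only_real_zeros (diag_op (\<lambda>n. 1) p)" using p by simp
  qed
  then show "preserves_real_rootedness T"
    by (simp add: preserves_real_rootedness_def preserves_real_rootedness_upto_def)
next
  assume T: "\<forall>n. T (monom 1 n) = laguerre_frak \<alpha> n"
  have "only_real_zeros (T p)" if p: "only_real_zeros p" for p
  proof (rule only_real_zeros_laguerre_operator[OF assms])
    show "T (monom 1 n) = smult (1 / fact n) (laguerre_cal \<alpha> n)" for n
      using T by (simp add: laguerre_frak_def laguerre_cal_def)
    show "only_real_zeros (diag_op (\<lambda>n. 1 / fact n) p)"
      \<comment> \<open>\<open>n! = (1)\<^sub>n\<close>, so this is the Laguerre multiplier for the parameter \<open>0\<close>.\<close>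
      using only_real_zeros_diag_op_inverse_pochhammer[of 0 p] p by (simp add: pochhammer_fact)
  qed
  then show "preserves_real_rootedness T"
    by (simp add: preserves_real_rootedness_def preserves_real_rootedness_upto_def)
qed

end
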